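(* Let $\Theta$ be a bounded linear operator on $L^2(\mathbb{R})$ with $\Theta\neq I$, where $I$ is the identity operator. Then $\Theta$ is hyponormal if and only if there exists a $(\Theta,1)$-Hilbert tight frame for $L^2(\mathbb{R})$.
   Context: A bounded linear operator $T$ on a Hilbert space $\mathcal{H}$ is hyponormal if $T^*T-TT^*\geq 0$, equivalently $\|T^*f\|\leq\|Tf\|$ for all $f\in\mathcal{H}$. Let $\Theta$ be a bounded linear operator on a Hilbert space $\mathcal{H}$. A countable sequence $\{f_n\}\subset\mathcal{H}$ is a $\Theta$-Hilbert frame for $\mathcal{H}$ with frame bounds $0<\alpha_0\leq\beta_0<\infty$ if $$\alpha_0\|\Theta^*f\|^2\leq\sum_{n}|\langle f,f_n\rangle|^2\leq\beta_0\|\Theta f\|^2\quad\text{for all } f\in\mathcal{H}.$$ For $\Theta\neq I$, a $\Theta$-Hilbert frame for $\mathcal{H}$ with frame bounds $\alpha_0=\beta_0$ is called a $(\Theta,\alpha_0)$-Hilbert tight frame. Thus a $(\Theta,1)$-Hilbert tight frame for $L^2(\mathbb{R})$ is a sequence $\{f_n\}\subset L^2(\mathbb{R})$ with $\|\Theta^*f\|^2\leq\sum_n|\langle f,f_n\rangle|^2\leq\|\Theta f\|^2$ for all $f\in L^2(\mathbb{R})$. *)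

theory Defs
  imports "HOL-Analysis.Analysis"
begin

class scaleC =
  fixes scaleC :: "complex \<Rightarrow> 'a \<Rightarrow> 'a" (infixr \<open>*\<^sub>C\<close> 75)

class complex_vector = real_vector + scaleC +
  assumes scaleR_scaleC: "scaleR r x = complex_of_real r *\<^sub>C x"
    and scaleC_add_right: "a *\<^sub>C (x + y) = a *\<^sub>C x + a *\<^sub>C y"
    and scaleC_add_left: "(a + b) *\<^sub>C x = a *\<^sub>C x + b *\<^sub>C x"
    and scaleC_scaleC: "a *\<^sub>C b *\<^sub>C x = (a * b) *\<^sub>C x"
    and scaleC_one: "1 *\<^sub>C x = x"

text \<open>
  The complex inner product is linear in its first argument.  Its real part is the library's
  real inner product, which supplies definiteness and the norm,
  \<open>norm x = sqrt (Re (cinner x x))\<close>.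
\<close>
class complex_inner = complex_vector + real_inner +
  fixes cinner :: "'a \<Rightarrow> 'a \<Rightarrow> complex"
  assumes cinner_commute: "cinner x y = cnj (cinner y x)"
    and cinner_add_left: "cinner (x + y) z = cinner x z + cinner y z"
    and cinner_scaleC_left: "cinner (a *\<^sub>C x) y = a * cinner x y"
    and inner_eq_Re_cinner: "inner x y = Re (cinner x y)"

class chilbert_space = complex_inner + complete_space

definition bounded_clinear :: "('a::chilbert_space \<Rightarrow> 'a) \<Rightarrow> bool" where
  "bounded_clinear T \<longleftrightarrow> bounded_linear T \<and> (\<forall>c x. T (c *\<^sub>C x) = c *\<^sub>C T x)"

text \<open>Meaningful for bounded operators, where the adjoint exists uniquely.\<close>
definition cadjoint :: "('a::chilbert_space \<Rightarrow> 'a) \<Rightarrow> ('a \<Rightarrow> 'a)" where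
  "cadjoint T = (SOME S. \<forall>x y. cinner (T x) y = cinner x (S y))"

definition positive_operator :: "('a::chilbert_space \<Rightarrow> 'a) \<Rightarrow> bool" where
  "positive_operator A \<longleftrightarrow> (\<forall>x. cinner (A x) x \<in> \<real>\<^sub>\<ge>\<^sub>0)"

definition hyponormal :: "('a::chilbert_space \<Rightarrow> 'a) \<Rightarrow> bool" where
  "hyponormal T \<longleftrightarrow> positive_operator (\<lambda>x. cadjoint T (T x) - T (cadjoint T x))"

text \<open>Summability is required explicitly, since \<open>suminf\<close> of a divergent series is unspecified.\<close>
definition theta_frame ::
    "('a::chilbert_space \<Rightarrow> 'a) \<Rightarrow> real \<Rightarrow> real \<Rightarrow> (nat \<Rightarrow> 'a) \<Rightarrow> bool" where
  "theta_frame \<Theta> \<alpha> \<beta> f \<longleftrightarrow> 0 < \<alpha> \<and> \<alpha> \<le> \<beta> \<and>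
     (\<forall>x. summable (\<lambda>n. (cmod (cinner x (f n)))\<^sup>2) \<and>
          \<alpha> * (norm (cadjoint \<Theta> x))\<^sup>2 \<le> (\<Sum>n. (cmod (cinner x (f n)))\<^sup>2) \<and>
          (\<Sum>n. (cmod (cinner x (f n)))\<^sup>2) \<le> \<beta> * (norm (\<Theta> x))\<^sup>2)"

definition theta_tight_frame ::
    "('a::chilbert_space \<Rightarrow> 'a) \<Rightarrow> real \<Rightarrow> (nat \<Rightarrow> 'a) \<Rightarrow> bool" where
  "theta_tight_frame \<Theta> \<alpha> f \<longleftrightarrow> \<Theta> \<noteq> id \<and> theta_frame \<Theta> \<alpha> \<alpha> f"

text \<open>
  Every Lebesgue measurable function agrees almost everywhere with a Borel measurable one, so the
  quotient of the Borel square-integrable functions by equality almost everywhere is all of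
  \<open>L\<^sup>2(\<real>)\<close>.
\<close>
definition square_integrable :: "(real \<Rightarrow> complex) \<Rightarrow> bool" where
  "square_integrable f \<longleftrightarrow>
     f \<in> borel_measurable lborel \<and> integrable lborel (\<lambda>x. (cmod (f x))\<^sup>2)"

definition L2_rel :: "(real \<Rightarrow> complex) \<Rightarrow> (real \<Rightarrow> complex) \<Rightarrow> bool" where
  "L2_rel f g \<longleftrightarrow> square_integrable f \<and> square_integrable g \<and> (AE x in lborel. f x = g x)"

lemma square_integrable_zero: "square_integrable (\<lambda>x. 0)"
  by (simp add: square_integrable_def)

lemma square_integrable_scale:
  assumes "square_integrable f" shows "square_integrable (\<lambda>x. c * f x)"
proof -
  have [measurable]: "f \<in> borel_measurable lborel"
    using assms by (simp add: square_integrable_def)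
  have "(\<lambda>x. c * f x) \<in> borel_measurable lborel" by measurable
  then show ?thesis
    using assms by (simp add: square_integrable_def norm_mult power_mult_distrib)
qed

lemma square_integrable_add:
  assumes "square_integrable f" "square_integrable g"
  shows "square_integrable (\<lambda>x. f x + g x)"
proof -
  have [measurable]: "f \<in> borel_measurable lborel" "g \<in> borel_measurable lborel"
    using assms by (auto simp: square_integrable_def)
  have "integrable lborel (\<lambda>x. (cmod (f x + g x))\<^sup>2)"
  proof (rule Bochner_Integration.integrable_bound)
    show "integrable lborel (\<lambda>x. 2 * (cmod (f x))\<^sup>2 + 2 * (cmod (g x))\<^sup>2)"
      using assms by (auto simp: square_integrable_def)
    have "(cmod (a + b))\<^sup>2 \<le> 2 * (cmod a)\<^sup>2 + 2 * (cmod b)\<^sup>2" for a b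
    proof -
      have "(cmod (a + b))\<^sup>2 \<le> (cmod a + cmod b)\<^sup>2"
        by (intro power_mono norm_triangle_ineq norm_ge_zero)
      also have "\<dots> \<le> 2 * (cmod a)\<^sup>2 + 2 * (cmod b)\<^sup>2"
        using zero_le_power2[of "cmod a - cmod b"] by (simp add: power2_eq_square algebra_simps)
      finally show ?thesis .
    qed
    then show "AE x in lborel. norm ((cmod (f x + g x))\<^sup>2)
        \<le> norm (2 * (cmod (f x))\<^sup>2 + 2 * (cmod (g x))\<^sup>2)"
      by (intro AE_I2) (smt (verit) real_norm_def zero_le_power2)
  qed measurable
  then show ?thesis by (simp add: square_integrable_def)
qed

lemma square_integrable_uminus:
  "square_integrable f \<Longrightarrow> square_integrable (\<lambda>x. - f x)"
  using square_integrable_scale[of f "-1"] by simp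

lemma square_integrable_diff:
  "square_integrable f \<Longrightarrow> square_integrable g \<Longrightarrow> square_integrable (\<lambda>x. f x - g x)"
  using square_integrable_add[OF _ square_integrable_uminus, of f g] by simp

lemma cnj_borel: "cnj \<in> borel_measurable borel"
  by (intro borel_measurable_continuous_onI continuous_intros)

lemma integrable_mult_cnj:
  assumes "square_integrable f" "square_integrable g"
  shows "integrable lborel (\<lambda>x. f x * cnj (g x))"
proof (rule Bochner_Integration.integrable_bound)
  have [measurable]: "f \<in> borel_measurable lborel" "g \<in> borel_measurable lborel"
    using assms by (auto simp: square_integrable_def)
  show "(\<lambda>x. f x * cnj (g x)) \<in> borel_measurable lborel"
    by (intro borel_measurable_times measurable_compose[OF _ cnj_borel]) measurable
  show "integrable lborel (\<lambda>x. (cmod (f x))\<^sup>2 + (cmod (g x))\<^sup>2)"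
    using assms by (auto simp: square_integrable_def)
  have "cmod (a * cnj b) \<le> (cmod a)\<^sup>2 + (cmod b)\<^sup>2" for a b
  proof -
    have "2 * (cmod a * cmod b) \<le> (cmod a)\<^sup>2 + (cmod b)\<^sup>2"
      using zero_le_power2[of "cmod a - cmod b"] by (simp add: power2_eq_square algebra_simps)
    moreover have "0 \<le> cmod a * cmod b" by simp
    ultimately show ?thesis by (simp only: norm_mult complex_mod_cnj)
  qed
  then show "AE x in lborel. cmod (f x * cnj (g x)) \<le> norm ((cmod (f x))\<^sup>2 + (cmod (g x))\<^sup>2)"
    by (intro AE_I2) (smt (verit) real_norm_def zero_le_power2)
qed

quotient_type L2 = "real \<Rightarrow> complex" / partial: L2_rel
proof (rule part_equivpI)
  show "\<exists>f. L2_rel f f"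
    using square_integrable_zero by (auto simp: L2_rel_def)
  show "symp L2_rel"
    by (auto simp: symp_def L2_rel_def elim: AE_mp)
  show "transp L2_rel"
    unfolding transp_def L2_rel_def by (auto elim: AE_mp)
qed

instantiation L2 :: complex_inner
begin

lift_definition zero_L2 :: L2 is "\<lambda>x. 0"
  by (simp add: L2_rel_def square_integrable_zero)

lift_definition plus_L2 :: "L2 \<Rightarrow> L2 \<Rightarrow> L2" is "\<lambda>f g x. f x + g x"
  by (auto simp: L2_rel_def square_integrable_add elim: AE_mp)

lift_definition minus_L2 :: "L2 \<Rightarrow> L2 \<Rightarrow> L2" is "\<lambda>f g x. f x - g x"
  by (auto simp: L2_rel_def square_integrable_diff elim: AE_mp)

lift_definition uminus_L2 :: "L2 \<Rightarrow> L2" is "\<lambda>f x. - f x"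
  by (auto simp: L2_rel_def square_integrable_uminus elim: AE_mp)

lift_definition scaleC_L2 :: "complex \<Rightarrow> L2 \<Rightarrow> L2" is "\<lambda>c f x. c * f x"
  by (auto simp: L2_rel_def square_integrable_scale elim: AE_mp)

lift_definition cinner_L2 :: "L2 \<Rightarrow> L2 \<Rightarrow> complex"
  is "\<lambda>f g. LINT x|lborel. f x * cnj (g x)"
proof -
  fix f f' g g' :: "real \<Rightarrow> complex"
  assume *: "L2_rel f f'" "L2_rel g g'"
  then have "AE x in lborel. f x * cnj (g x) = f' x * cnj (g' x)"
    by (auto simp: L2_rel_def elim: AE_mp)
  then show "(LINT x|lborel. f x * cnj (g x)) = (LINT x|lborel. f' x * cnj (g' x))"
    using * by (intro integral_cong_AE borel_measurable_integrable integrable_mult_cnj)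
      (auto simp: L2_rel_def)
qed

definition scaleR_L2 :: "real \<Rightarrow> L2 \<Rightarrow> L2" where
  "scaleR_L2 r x = complex_of_real r *\<^sub>C x"

definition inner_L2 :: "L2 \<Rightarrow> L2 \<Rightarrow> real" where
  "inner_L2 x y = Re (cinner x y)"

definition norm_L2 :: "L2 \<Rightarrow> real" where
  "norm_L2 x = sqrt (inner x x)"

definition sgn_L2 :: "L2 \<Rightarrow> L2" where
  "sgn_L2 x = inverse (norm x) *\<^sub>R x"

definition dist_L2 :: "L2 \<Rightarrow> L2 \<Rightarrow> real" where
  "dist_L2 x y = norm (x - y)"

definition uniformity_L2 :: "(L2 \<times> L2) filter" where
  "uniformity_L2 = (INF e\<in>{0<..}. principal {(x, y). dist x y < e})"

definition open_L2 :: "L2 set \<Rightarrow> bool" where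
  "open_L2 U \<longleftrightarrow> (\<forall>x\<in>U. \<forall>\<^sub>F (x', y) in uniformity. x' = x \<longrightarrow> y \<in> U)"

lemma inner_L2_abs:
  assumes "square_integrable f"
  shows "inner (abs_L2 f) (abs_L2 f) = (LINT x|lborel. (cmod (f x))\<^sup>2)"
proof -
  have "L2_rel f f" using assms by (simp add: L2_rel_def)
  then have "cinner (abs_L2 f) (abs_L2 f) = (LINT x|lborel. f x * cnj (f x))"
    by (simp add: cinner_L2.abs_eq)
  also have "\<dots> = (LINT x|lborel. complex_of_real ((cmod (f x))\<^sup>2))"
    by (simp only: complex_norm_square)
  also have "\<dots> = complex_of_real (LINT x|lborel. (cmod (f x))\<^sup>2)"
    by (rule integral_complex_of_real)
  finally show ?thesis by (simp add: inner_L2_def)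
qed

lemma L2_obtain:
  fixes x :: L2
  obtains f where "square_integrable f" "x = abs_L2 f"
proof -
  have "\<exists>f. square_integrable f \<and> x = abs_L2 f"
    by (metis L2_rel_def Quotient_L2 Quotient_abs_rep Quotient_rep_reflp)
  then show thesis using that by blast
qed

instance
proof
  fix x y z :: L2 and a b :: complex and r s :: real
  show "x + y + z = x + (y + z)" "x + y = y + x" "0 + x = x" "- x + x = 0" "x - y = x + - y"
    by (transfer, auto simp: L2_rel_def algebra_simps square_integrable_zero
      intro!: square_integrable_add square_integrable_diff square_integrable_uminus)+
  have C1: "a *\<^sub>C (x + y) = a *\<^sub>C x + a *\<^sub>C y" for a and x y :: L2
    by (transfer, auto simp: L2_rel_def algebra_simps
      intro!: square_integrable_add square_integrable_scale)
  have C2: "(a + b) *\<^sub>C x = a *\<^sub>C x + b *\<^sub>C x" for a b and x :: L2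
    by (transfer, auto simp: L2_rel_def distrib_right
      intro!: square_integrable_add square_integrable_scale)
  have C3: "a *\<^sub>C b *\<^sub>C x = (a * b) *\<^sub>C x" for a b and x :: L2
    by (transfer, auto simp: L2_rel_def mult.assoc intro!: square_integrable_scale)
  have C4: "1 *\<^sub>C x = x" for x :: L2
    by (transfer, auto simp: L2_rel_def)
  show "a *\<^sub>C (x + y) = a *\<^sub>C x + a *\<^sub>C y" "(a + b) *\<^sub>C x = a *\<^sub>C x + b *\<^sub>C x"
    "a *\<^sub>C b *\<^sub>C x = (a * b) *\<^sub>C x" "1 *\<^sub>C x = x"
    by (fact C1 C2 C3 C4)+
  show "r *\<^sub>R (x + y) = r *\<^sub>R x + r *\<^sub>R y" "(r + s) *\<^sub>R x = r *\<^sub>R x + s *\<^sub>R x"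
    "r *\<^sub>R s *\<^sub>R x = (r * s) *\<^sub>R x" "1 *\<^sub>R x = x"
    by (simp_all add: scaleR_L2_def C1 C2 C3 C4)
  show "r *\<^sub>R x = complex_of_real r *\<^sub>C x" by (fact scaleR_L2_def)
  have D1: "cinner x y = cnj (cinner y x)" for x y :: L2
    by (transfer, simp only: Bochner_Integration.integral_cnj[symmetric] complex_cnj_mult
        complex_cnj_cnj mult.commute)
  have D2: "cinner (x + y) z = cinner x z + cinner y z" for x y z :: L2
    by (transfer, simp add: L2_rel_def distrib_right Bochner_Integration.integral_add
        integrable_mult_cnj)
  have D3: "cinner (a *\<^sub>C x) y = a * cinner x y" for a and x y :: L2
    by (transfer, simp add: L2_rel_def mult.assoc)
  show "cinner x y = cnj (cinner y x)" "cinner (x + y) z = cinner x z + cinner y z"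
    "cinner (a *\<^sub>C x) y = a * cinner x y" "inner x y = Re (cinner x y)"
    by (fact D1 D2 D3 inner_L2_def)+
  show "inner x y = inner y x"
    unfolding inner_L2_def by (subst D1) simp
  show "inner (x + y) z = inner x z + inner y z"
    by (simp add: inner_L2_def D2)
  show "inner (r *\<^sub>R x) y = r * inner x y"
    by (simp add: inner_L2_def D3 scaleR_L2_def)
  obtain f where f: "square_integrable f" "x = abs_L2 f" by (rule L2_obtain)
  show "0 \<le> inner x x" by (simp add: f inner_L2_abs)
  show "inner x x = 0 \<longleftrightarrow> x = 0"
  proof -
    have "inner x x = 0 \<longleftrightarrow> (AE t in lborel. (cmod (f t))\<^sup>2 = 0)"
      using f by (simp add: inner_L2_abs square_integrable_def integral_nonneg_eq_0_iff_AE)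
    also have "\<dots> \<longleftrightarrow> L2_rel f (\<lambda>x. 0)"
      using f by (simp add: L2_rel_def square_integrable_zero)
    also have "\<dots> \<longleftrightarrow> x = 0"
      using Quotient_rel[OF Quotient_L2, of f "\<lambda>x. 0"] f
      by (simp add: zero_L2_def L2_rel_def square_integrable_zero)
    finally show ?thesis .
  qed
  show "norm x = sqrt (inner x x)" "sgn x = inverse (norm x) *\<^sub>R x" "dist x y = norm (x - y)"
    by (fact norm_L2_def sgn_L2_def dist_L2_def)+
qed (fact uniformity_L2_def open_L2_def)+

end

lemma norm_L2_abs:
  assumes "square_integrable f"
  shows "ennreal ((norm (abs_L2 f))\<^sup>2) = (\<integral>\<^sup>+x. ennreal ((cmod (f x))\<^sup>2) \<partial>lborel)"
proof -
  have "(norm (abs_L2 f))\<^sup>2 = (LINT x|lborel. (cmod (f x))\<^sup>2)"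
    using assms by (simp add: power2_norm_eq_inner inner_L2_abs)
  then show ?thesis
    using assms by (simp add: square_integrable_def nn_integral_eq_integral)
qed

lemma diff_L2_abs:
  assumes "square_integrable f" "square_integrable g"
  shows "abs_L2 f - abs_L2 g = abs_L2 (\<lambda>x. f x - g x)"
  using assms by (intro minus_L2.abs_eq) (simp_all add: L2_rel_def)

instance L2 :: chilbert_space
proof
  fix X :: "nat \<Rightarrow> L2"
  assume "Cauchy X"
  then have "\<exists>N. \<forall>m\<ge>N. \<forall>n\<ge>N. dist (X m) (X n) < (1/4)^k" for k
    by (intro metric_CauchyD) auto
  then obtain N where N: "\<And>k m n. m \<ge> N k \<Longrightarrow> n \<ge> N k \<Longrightarrow> dist (X m) (X n) < (1/4)^k"
    by metis
  define r where "r k = (\<Sum>i\<le>k. N i) + k" for k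
  have r: "strict_mono r"
    by (rule strict_monoI_Suc) (simp add: r_def)
  have rN: "N k \<le> r j" if "k \<le> j" for k j
    using member_le_sum[of k "{..j}" N] that by (simp add: r_def)
  have near: "dist (X (r m)) (X (r n)) < (1/4)^k" if "k \<le> m" "k \<le> n" for k m n
    using that by (intro N rN)
  have "\<exists>f. square_integrable f \<and> X (r k) = abs_L2 f" for k
    by (rule L2_obtain[of "X (r k)"]) auto
  then obtain G where G: "\<And>k. square_integrable (G k)" "\<And>k. X (r k) = abs_L2 (G k)"
    by metis
  have Gm [measurable]: "G k \<in> borel_measurable lborel" for k
    using G(1) by (simp add: square_integrable_def)
  have diff: "(\<integral>\<^sup>+x. ennreal ((cmod (G m x - G n x))\<^sup>2) \<partial>lborel) \<le> ennreal (((1/4)^k)\<^sup>2)"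
    if "k \<le> m" "k \<le> n" for k m n
  proof -
    have "norm (abs_L2 (\<lambda>x. G m x - G n x)) < (1/4)^k"
      using near[OF that] by (simp add: G(2) dist_norm diff_L2_abs G(1))
    then show ?thesis
      by (subst norm_L2_abs[symmetric])
        (auto intro!: ennreal_leI power_mono square_integrable_diff G(1))
  qed
  define D where "D k x = G (Suc k) x - G k x" for k x
  have Dm [measurable]: "D k \<in> borel_measurable lborel" for k
    unfolding D_def by measurable
  have "(\<integral>\<^sup>+x. (\<Sum>k. ennreal (4^k * (cmod (D k x))\<^sup>2)) \<partial>lborel)
      = (\<Sum>k. \<integral>\<^sup>+x. ennreal (4^k * (cmod (D k x))\<^sup>2) \<partial>lborel)"
    by (rule nn_integral_suminf) measurable
  also have "\<dots> \<le> (\<Sum>k. ennreal ((1/4)^k))"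
  proof (rule suminf_le)
    fix k
    have "(\<integral>\<^sup>+x. ennreal (4^k * (cmod (D k x))\<^sup>2) \<partial>lborel)
        = ennreal (4^k) * (\<integral>\<^sup>+x. ennreal ((cmod (D k x))\<^sup>2) \<partial>lborel)"
      by (subst nn_integral_cmult[symmetric]) (auto simp: ennreal_mult)
    also have "\<dots> \<le> ennreal (4^k) * ennreal (((1/4)^k)\<^sup>2)"
      unfolding D_def by (intro mult_left_mono diff) auto
    also have "\<dots> = ennreal ((1/4)^k)"
      by (simp add: ennreal_mult[symmetric] power2_eq_square power_divide)
    finally show "(\<integral>\<^sup>+x. ennreal (4^k * (cmod (D k x))\<^sup>2) \<partial>lborel) \<le> ennreal ((1/4)^k)" .
  qed auto
  also have "\<dots> = ennreal (\<Sum>k. (1/4)^k)"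
    by (intro suminf_ennreal2 summable_geometric) auto
  finally have "(\<integral>\<^sup>+x. (\<Sum>k. ennreal (4^k * (cmod (D k x))\<^sup>2)) \<partial>lborel) \<noteq> \<infinity>"
    by (auto simp: top_unique)
  then have "AE x in lborel. (\<Sum>k. ennreal (4^k * (cmod (D k x))\<^sup>2)) \<noteq> \<infinity>"
    by (intro nn_integral_PInf_AE) measurable
  then have conv: "AE x in lborel. convergent (\<lambda>k. G k x)"
  proof eventually_elim
    case (elim x)
    then have "summable (\<lambda>k. 4^k * (cmod (D k x))\<^sup>2)"
      by (intro summable_suminf_not_top) auto
    then have "Bseq (\<lambda>k. 4^k * (cmod (D k x))\<^sup>2)"
      by (intro convergent_imp_Bseq summable_LIMSEQ_zero[THEN convergentI])
    then obtain C where C: "C > 0" and "\<And>k. norm (4^k * (cmod (D k x))\<^sup>2) \<le> C"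
      by (rule BseqE) blast
    then have Cb: "4^k * (cmod (D k x))\<^sup>2 \<le> C" for k
      by (metis abs_le_D1 real_norm_def)
    have "cmod (D k x) \<le> sqrt C * (1/2)^k" for k
    proof (rule power2_le_imp_le)
      show "(cmod (D k x))\<^sup>2 \<le> (sqrt C * (1/2)^k)\<^sup>2"
        (is "?l \<le> ?r")
      proof -
        have "?l = (1/4)^k * (4^k * ?l)"
        proof -
          have "(1/4::real)^k * 4^k = 1"
            by (simp only: power_mult_distrib[symmetric]) simp
          then show ?thesis by (simp only: mult.assoc[symmetric] mult_1_left)
        qed
        also have "\<dots> \<le> (1/4)^k * C"
          by (rule mult_left_mono[OF Cb]) simp
        also have "\<dots> = ?r"
        proof -
          have "((1/2::real)^k)\<^sup>2 = (1/4)^k"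
            by (simp only: power2_eq_square power_mult_distrib[symmetric]) simp
          then show ?thesis
            using C by (simp only: power_mult_distrib real_sqrt_pow2 less_imp_le mult.commute)
        qed
        finally show ?thesis .
      qed
    qed (use C in auto)
    then have "\<exists>N. \<forall>n\<ge>N. norm (D n x) \<le> sqrt C * (1/2)^n"
      by blast
    moreover have "summable (\<lambda>k. sqrt C * (1/2)^k)"
      by (rule summable_mult, rule summable_geometric, simp)
    ultimately have "summable (\<lambda>k. D k x)"
      by (rule summable_comparison_test)
    then have "convergent (\<lambda>n. \<Sum>k<n. D k x)"
      by (simp only: summable_iff_convergent)
    moreover have "(\<Sum>k<n. D k x) = G n x - G 0 x" for n
      unfolding D_def by (rule sum_lessThan_telescope)
    ultimately have "convergent (\<lambda>n. G n x - G 0 x)"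
      by (simp only:)
    then have "convergent (\<lambda>k. G 0 x + (G k x - G 0 x))"
      by (rule convergent_add[OF convergent_const])
    then show "convergent (\<lambda>k. G k x)" by simp
  qed
  define f where "f x = lim (\<lambda>k. G k x)" for x
  have [measurable]: "f \<in> borel_measurable lborel"
    unfolding f_def by measurable
  have lim: "AE x in lborel. (\<lambda>k. G k x) \<longlonglongrightarrow> f x"
    using conv by eventually_elim (simp add: f_def convergent_LIMSEQ_iff)
  have tail: "(\<integral>\<^sup>+x. ennreal ((cmod (G k x - f x))\<^sup>2) \<partial>lborel) \<le> ennreal (((1/4)^k)\<^sup>2)" for k
  proof -
    have "(\<integral>\<^sup>+x. ennreal ((cmod (G k x - f x))\<^sup>2) \<partial>lborel)
        = (\<integral>\<^sup>+x. liminf (\<lambda>j. ennreal ((cmod (G k x - G j x))\<^sup>2)) \<partial>lborel)"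
    proof (rule nn_integral_cong_AE, use lim in eventually_elim)
      case (elim x)
      then have "(\<lambda>j. ennreal ((cmod (G k x - G j x))\<^sup>2)) \<longlonglongrightarrow> ennreal ((cmod (G k x - f x))\<^sup>2)"
        by (intro tendsto_intros)
      then show ?case
        by (intro lim_imp_Liminf[symmetric]) auto
    qed
    also have "\<dots> \<le> liminf (\<lambda>j. \<integral>\<^sup>+x. ennreal ((cmod (G k x - G j x))\<^sup>2) \<partial>lborel)"
      by (rule nn_integral_liminf) measurable
    also have "\<dots> \<le> liminf (\<lambda>j. ennreal (((1/4)^k)\<^sup>2))"
      by (intro Liminf_mono eventually_sequentiallyI[of k] diff) auto
    also have "\<dots> = ennreal (((1/4)^k)\<^sup>2)"
      by (simp add: Liminf_const)
    finally show ?thesis .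
  qed
  have sq: "square_integrable (\<lambda>x. G k x - f x)" for k
  proof -
    have "integrable lborel (\<lambda>x. (cmod (G k x - f x))\<^sup>2)"
    proof (rule integrableI_bounded)
      have "(\<integral>\<^sup>+x. ennreal (norm ((cmod (G k x - f x))\<^sup>2)) \<partial>lborel) \<le> ennreal (((1/4)^k)\<^sup>2)"
        using tail[of k] by simp
      also have "\<dots> < \<infinity>" by simp
      finally show "(\<integral>\<^sup>+x. ennreal (norm ((cmod (G k x - f x))\<^sup>2)) \<partial>lborel) < \<infinity>" .
    qed measurable
    then show ?thesis by (simp add: square_integrable_def)
  qed
  have sqf: "square_integrable f"
    using square_integrable_diff[OF G(1) sq, of 0 0] by simp
  have bound: "dist (X (r k)) (abs_L2 f) \<le> (1/4)^k" for k
  proof -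
    have "ennreal ((norm (abs_L2 (\<lambda>x. G k x - f x)))\<^sup>2) \<le> ennreal (((1/4)^k)\<^sup>2)"
      using tail by (simp only: norm_L2_abs[OF sq])
    then have "(norm (abs_L2 (\<lambda>x. G k x - f x)))\<^sup>2 \<le> ((1/4)^k)\<^sup>2"
      by (simp add: ennreal_le_iff)
    then have "norm (abs_L2 (\<lambda>x. G k x - f x)) \<le> (1/4)^k"
      by (rule power2_le_imp_le) simp
    then show ?thesis
      by (simp add: G(2) dist_norm diff_L2_abs G(1) sqf)
  qed
  have "(X \<circ> r) \<longlonglongrightarrow> abs_L2 f"
  proof (rule metric_tendsto_imp_tendsto)
    show "(\<lambda>k. (1/4)^k) \<longlonglongrightarrow> (0::real)"
      by (rule LIMSEQ_power_zero) simp
    show "\<forall>\<^sub>F k in sequentially. dist ((X \<circ> r) k) (abs_L2 f) \<le> dist ((1/4)^k) (0::real)"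
      using bound by simp
  qed
  with \<open>Cauchy X\<close> r have "X \<longlonglongrightarrow> abs_L2 f"
    by (rule Cauchy_converges_subseq)
  then show "convergent X" by (rule convergentI)
qed

end

theory Submission
  imports Defs
begin

text \<open>
  Hyponormality of \<open>T\<close> says that \<open>norm (cadjoint T x) \<le> norm (T x)\<close> for all \<open>x\<close>, because
  \<open>cinner (cadjoint T (T x) - T (cadjoint T x)) x\<close> is the difference of the two squared norms
  (\<open>hyponormal_iff_norm_le\<close>). The two inequalities of a tight frame with bound \<open>1\<close> enclose the
  frame sum between these squares, so such a frame forces hyponormality. Conversely, let \<open>e\<close>
  be a total orthonormal sequence, up to entries that are \<open>0\<close>. Since \<open>cinner x (T (e n)) = cinner (cadjoint T x) (e n)\<close>, Parseval's
  identity (\<open>Parseval_sums\<close>) shows that the frame sum of the image sequence \<open>\<lambda>n. T (e n)\<close> equals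
  \<open>(norm (cadjoint T x))\<^sup>2\<close>: the lower bound holds with equality, and the upper bound is
  hyponormality.

  Everything therefore rests on such a sequence in \<open>L\<^sup>2(\<real>)\<close>. The indicator
  functions of the intervals with rational endpoints are total there (\<open>rat_interval_L2_total\<close>),
  because a function whose integrals over all these intervals vanish is zero almost everywhere;
  Gram-Schmidt turns them into an orthonormal sequence without losing totality
  (\<open>gram_schmidt_total\<close>). The same sequence also yields the adjoint of a bounded operator, as an
  explicit convergent series (\<open>cinner_cadjoint\<close>), in place of the Riesz representation theorem.
\<close>

section \<open>The complex inner product\<close>

lemma mult_cnj_cmod: "z * cnj z = (complex_of_real (cmod z))\<^sup>2"
  by (metis complex_norm_square of_real_power)

lemma cinner_add_right: "cinner x (y + z) = cinner x y + cinner x (z::'a::complex_inner)"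
  by (metis cinner_add_left cinner_commute complex_cnj_add)

lemma cinner_scaleC_right: "cinner x (a *\<^sub>C y) = cnj a * cinner x (y::'a::complex_inner)"
  by (metis cinner_commute cinner_scaleC_left complex_cnj_mult)

lemma cinner_zero_left [simp]: "cinner 0 (x::'a::complex_inner) = 0"
  using cinner_add_left[of 0 0 x] by simp

lemma cinner_zero_right [simp]: "cinner (x::'a::complex_inner) 0 = 0"
  using cinner_add_right[of x 0 0] by simp

lemma cinner_eq_zero_commute: "cinner x y = 0 \<longleftrightarrow> cinner y (x::'a::complex_inner) = 0"
  by (metis cinner_commute complex_cnj_zero)

lemma cinner_diff_left: "cinner (x - y) z = cinner x z - cinner y (z::'a::complex_inner)"
  using cinner_add_left[of "x - y" y z] by simp

lemma cinner_scaleR_left: "cinner (r *\<^sub>R x) y = of_real r * cinner x (y::'a::complex_inner)"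
  by (simp add: scaleR_scaleC cinner_scaleC_left)

lemma cinner_scaleR_right: "cinner x (r *\<^sub>R y) = of_real r * cinner x (y::'a::complex_inner)"
  by (simp add: scaleR_scaleC cinner_scaleC_right)

lemma cinner_sum_left: "cinner (\<Sum>i\<in>A. f i) y = (\<Sum>i\<in>A. cinner (f i) (y::'a::complex_inner))"
  by (induction A rule: infinite_finite_induct) (simp_all add: cinner_add_left)

lemma cinner_sum_right: "cinner y (\<Sum>i\<in>A. f i) = (\<Sum>i\<in>A. cinner (y::'a::complex_inner) (f i))"
  by (induction A rule: infinite_finite_induct) (simp_all add: cinner_add_right)

lemma cinner_self: "cinner x x = of_real ((norm (x::'a::complex_inner))\<^sup>2)"
proof (rule complex_eqI)
  show "Im (cinner x x) = Im (of_real ((norm x)\<^sup>2))"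
    using arg_cong[OF cinner_commute[of x x], of Im] by simp
qed (simp add: power2_norm_eq_inner inner_eq_Re_cinner)

text \<open>
  Multiplying \<open>x\<close> by the phase that makes \<open>cinner x y\<close> real and nonnegative turns this into the
  Cauchy-Schwarz inequality of the underlying real inner product.
\<close>
lemma cinner_Cauchy_Schwarz: "cmod (cinner x y) \<le> norm x * norm (y::'a::complex_inner)"
proof (cases "cinner x y = 0")
  case False
  define c where "c = cnj (sgn (cinner x y))"
  have c: "cmod c = 1"
    using False by (simp add: c_def norm_sgn)
  have n: "norm (c *\<^sub>C x) = norm x"
  proof -
    have "complex_of_real ((norm (c *\<^sub>C x))\<^sup>2) = (c * cnj c) * of_real ((norm x)\<^sup>2)"
      by (simp only: cinner_self[symmetric] cinner_scaleC_left cinner_scaleC_right mult.assoc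
          mult.left_commute)
    also have "\<dots> = of_real ((norm x)\<^sup>2)"
      using c by (simp add: complex_norm_square[symmetric])
    finally show ?thesis
      by (metis norm_ge_zero of_real_eq_iff power2_eq_imp_eq)
  qed
  have "cinner (c *\<^sub>C x) y = of_real (cmod (cinner x y))"
    using False
    by (simp add: cinner_scaleC_left c_def sgn_eq mult_cnj_cmod power2_eq_square mult.commute)
  then have "cmod (cinner x y) = inner (c *\<^sub>C x) y"
    by (simp add: inner_eq_Re_cinner)
  also have "\<dots> \<le> norm (c *\<^sub>C x) * norm y"
    by (rule norm_cauchy_schwarz)
  finally show ?thesis by (simp add: n)
qed simp

lemma bounded_bilinear_cinner:
  "bounded_bilinear (cinner :: 'a::complex_inner \<Rightarrow> 'a \<Rightarrow> complex)"
proof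
  show "\<exists>K. \<forall>a b. norm (cinner a (b::'a)) \<le> norm a * norm b * K"
    by (intro exI[of _ 1]) (simp add: cinner_Cauchy_Schwarz)
qed (simp_all add: cinner_add_left cinner_add_right cinner_scaleR_left cinner_scaleR_right
    scaleR_conv_of_real)

lemmas bounded_linear_cinner_left = bounded_bilinear.bounded_linear_left[OF bounded_bilinear_cinner]
lemmas bounded_linear_cinner_right = bounded_bilinear.bounded_linear_right[OF bounded_bilinear_cinner]


section \<open>Orthonormal sequences and Parseval's identity\<close>

text \<open>
  Zero entries are admitted so that Gram-Schmidt needs no case distinction on linear dependence;
  they contribute nothing to any of the expansions below.
\<close>
definition orthonormal_or_zero :: "(nat \<Rightarrow> 'a::complex_inner) \<Rightarrow> bool" where
  "orthonormal_or_zero e \<longleftrightarrow>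
     (\<forall>i j. i \<noteq> j \<longrightarrow> cinner (e i) (e j) = 0) \<and> (\<forall>i. e i = 0 \<or> norm (e i) = 1)"

definition total_sequence :: "(nat \<Rightarrow> 'a::complex_inner) \<Rightarrow> bool" where
  "total_sequence v \<longleftrightarrow> (\<forall>x. (\<forall>n. cinner x (v n) = 0) \<longrightarrow> x = 0)"

lemma orthonormal_or_zero_coeff:
  assumes "orthonormal_or_zero e" "finite A"
  shows "cinner (\<Sum>i\<in>A. c i *\<^sub>C e i) (e j) = (if j \<in> A \<and> e j \<noteq> 0 then c j else 0)"
proof -
  have "cinner (e i) (e j) = (if i = j \<and> e j \<noteq> 0 then 1 else 0)" for i
    using assms(1) by (auto simp: orthonormal_or_zero_def cinner_self)
  then have "cinner (\<Sum>i\<in>A. c i *\<^sub>C e i) (e j) = (\<Sum>i\<in>A. if i = j then (if e j \<noteq> 0 then c j else 0) else 0)"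
    by (auto simp: cinner_sum_left cinner_scaleC_left intro!: sum.cong)
  then show ?thesis
    using assms(2) by (simp add: sum.delta)
qed

text \<open>Pythagoras, with an inequality because the zero entries of \<open>e\<close> drop out on the left.\<close>
lemma norm_orthonormal_sum_le:
  assumes "orthonormal_or_zero e" "finite A"
  shows "(norm (\<Sum>i\<in>A. c i *\<^sub>C e i))\<^sup>2 \<le> (\<Sum>i\<in>A. (cmod (c i))\<^sup>2)"
proof -
  let ?s = "\<Sum>i\<in>A. c i *\<^sub>C e i"
  have "complex_of_real ((norm ?s)\<^sup>2) = (\<Sum>i\<in>A. cnj (c i) * cinner ?s (e i))"
    by (simp only: cinner_self[symmetric] cinner_sum_right cinner_scaleC_right)
  also have "\<dots> = of_real (\<Sum>i\<in>A. if e i \<noteq> 0 then (cmod (c i))\<^sup>2 else 0)"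
    unfolding of_real_sum
    by (rule sum.cong) (auto simp: orthonormal_or_zero_coeff[OF assms] mult_cnj_cmod mult.commute)
  finally have "(norm ?s)\<^sup>2 = (\<Sum>i\<in>A. if e i \<noteq> 0 then (cmod (c i))\<^sup>2 else 0)"
    by (simp only: of_real_eq_iff)
  also have "\<dots> \<le> (\<Sum>i\<in>A. (cmod (c i))\<^sup>2)"
    by (rule sum_mono) simp
  finally show ?thesis .
qed

lemma summable_orthonormal:
  fixes e :: "nat \<Rightarrow> 'a::chilbert_space"
  assumes e: "orthonormal_or_zero e" and c: "summable (\<lambda>n. (cmod (c n))\<^sup>2)"
  shows "summable (\<lambda>n. c n *\<^sub>C e n)"
  unfolding summable_iff_convergent
proof (rule Cauchy_convergent, rule CauchyI)
  fix \<epsilon> :: real assume "0 < \<epsilon>"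
  have "Cauchy (\<lambda>n. \<Sum>i<n. (cmod (c i))\<^sup>2)"
    using c by (simp add: summable_iff_convergent convergent_Cauchy)
  then obtain N where
    N: "\<And>m n. m \<ge> N \<Longrightarrow> n \<ge> N \<Longrightarrow> norm ((\<Sum>i<m. (cmod (c i))\<^sup>2) - (\<Sum>i<n. (cmod (c i))\<^sup>2)) < \<epsilon>\<^sup>2"
    using CauchyD[of _ "\<epsilon>\<^sup>2"] \<open>0 < \<epsilon>\<close> by (metis zero_less_power)
  have less: "norm ((\<Sum>i<n. c i *\<^sub>C e i) - (\<Sum>i<m. c i *\<^sub>C e i)) < \<epsilon>"
    if "N \<le> m" "m \<le> n" for m n
  proof (rule power2_less_imp_less)
    have split: "(\<Sum>i<n. g i) - (\<Sum>i<m. g i) = (\<Sum>i\<in>{m..<n}. g i)" for g :: "nat \<Rightarrow> 'b::ab_group_add"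
      using sum_diff_nat_ivl[of 0 m n g] that by (simp add: lessThan_atLeast0)
    have "(norm ((\<Sum>i<n. c i *\<^sub>C e i) - (\<Sum>i<m. c i *\<^sub>C e i)))\<^sup>2 \<le> (\<Sum>i\<in>{m..<n}. (cmod (c i))\<^sup>2)"
      unfolding split by (rule norm_orthonormal_sum_le[OF e]) simp
    also have "\<dots> < \<epsilon>\<^sup>2"
      using N[of n m] that unfolding split by simp
    finally show "(norm ((\<Sum>i<n. c i *\<^sub>C e i) - (\<Sum>i<m. c i *\<^sub>C e i)))\<^sup>2 < \<epsilon>\<^sup>2" .
  qed (use \<open>0 < \<epsilon>\<close> in simp)
  show "\<exists>M. \<forall>m\<ge>M. \<forall>n\<ge>M. norm ((\<Sum>i<m. c i *\<^sub>C e i) - (\<Sum>i<n. c i *\<^sub>C e i)) < \<epsilon>"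
  proof (intro exI allI impI)
    fix m n assume "N \<le> m" "N \<le> n"
    then show "norm ((\<Sum>i<m. c i *\<^sub>C e i) - (\<Sum>i<n. c i *\<^sub>C e i)) < \<epsilon>"
      using less[of m n] less[of n m] by (metis nle_le norm_minus_commute)
  qed
qed

text \<open>
  Expanding \<open>0 \<le> (norm (x - s))\<^sup>2\<close> for the partial sum \<open>s\<close> of the Fourier series of \<open>x\<close>
  bounds the partial sums of the coefficients.
\<close>
lemma Bessel_inequality:
  assumes e: "orthonormal_or_zero e" and "finite A"
  shows "(\<Sum>i\<in>A. (cmod (cinner x (e i)))\<^sup>2) \<le> (norm x)\<^sup>2"
proof -
  let ?s = "\<Sum>i\<in>A. cinner x (e i) *\<^sub>C e i"
  let ?B = "\<Sum>i\<in>A. (cmod (cinner x (e i)))\<^sup>2"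
  have "cinner x ?s = of_real ?B"
    by (simp add: cinner_sum_right cinner_scaleC_right mult_cnj_cmod mult.commute)
  then have xs: "inner x ?s = ?B"
    by (simp add: inner_eq_Re_cinner)
  have "0 \<le> (norm (x - ?s))\<^sup>2" by simp
  also have "\<dots> = (norm x)\<^sup>2 - 2 * inner x ?s + (norm ?s)\<^sup>2"
    by (simp add: power2_norm_eq_inner inner_diff_left inner_diff_right inner_commute)
  also have "\<dots> \<le> (norm x)\<^sup>2 - ?B"
    using norm_orthonormal_sum_le[OF e \<open>finite A\<close>, of "\<lambda>i. cinner x (e i)"] xs by linarith
  finally show ?thesis by simp
qed

lemma summable_Fourier_coeffs:
  assumes "orthonormal_or_zero e"
  shows "summable (\<lambda>n. (cmod (cinner x (e n)))\<^sup>2)"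
  by (rule summableI_nonneg_bounded[of _ "(norm x)\<^sup>2"]) (simp_all add: Bessel_inequality[OF assms])

text \<open>
  The Fourier series converges by completeness, and its limit has the same coefficients as \<open>x\<close>;
  so the difference is orthogonal to the whole total sequence.
\<close>
lemma Fourier_series_sums:
  fixes e :: "nat \<Rightarrow> 'a::chilbert_space"
  assumes e: "orthonormal_or_zero e" and total: "total_sequence e"
  shows "(\<lambda>n. cinner x (e n) *\<^sub>C e n) sums x"
proof -
  let ?c = "\<lambda>n. cinner x (e n)"
  define s where "s = (\<Sum>n. ?c n *\<^sub>C e n)"
  have sums: "(\<lambda>n. ?c n *\<^sub>C e n) sums s"
    unfolding s_def
    by (intro summable_sums summable_orthonormal e summable_Fourier_coeffs)
  have "cinner (x - s) (e j) = 0" for j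
  proof -
    have "(\<lambda>n. cinner (\<Sum>i<n. ?c i *\<^sub>C e i) (e j)) \<longlonglongrightarrow> cinner s (e j)"
      using sums unfolding sums_def by (rule bounded_linear.tendsto[OF bounded_linear_cinner_left])
    moreover have "\<forall>\<^sub>F n in sequentially. cinner (\<Sum>i<n. ?c i *\<^sub>C e i) (e j) = ?c j"
      using eventually_gt_at_top[of j]
      by eventually_elim (auto simp: orthonormal_or_zero_coeff[OF e])
    ultimately have "cinner s (e j) = ?c j"
      by (rule LIMSEQ_unique[OF _ tendsto_eventually])
    then show ?thesis by (simp add: cinner_diff_left)
  qed
  then have "x - s = 0"
    using total unfolding total_sequence_def by blast
  with sums show ?thesis by simp
qed

lemma Parseval_sums:
  fixes e :: "nat \<Rightarrow> 'a::chilbert_space"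
  assumes "orthonormal_or_zero e" "total_sequence e"
  shows "(\<lambda>n. (cmod (cinner x (e n)))\<^sup>2) sums (norm x)\<^sup>2"
proof -
  have "(\<lambda>n. cinner (cinner x (e n) *\<^sub>C e n) x) sums cinner x x"
    by (rule bounded_linear.sums[OF bounded_linear_cinner_left Fourier_series_sums[OF assms]])
  moreover have "cinner (cinner x (e n) *\<^sub>C e n) x = of_real ((cmod (cinner x (e n)))\<^sup>2)" for n
    by (simp add: cinner_scaleC_left cinner_commute[of "e n" x] mult_cnj_cmod)
  ultimately show ?thesis
    by (simp only: cinner_self sums_of_real_iff)
qed


section \<open>Existence of adjoints\<close>

text \<open>
  Testing \<open>y\<close> against \<open>T\<close> applied to the partial sum \<open>z\<close> with coefficients
  \<open>cinner y (T (e i))\<close> gives \<open>B \<le> norm y * K * norm z \<le> norm y * K * sqrt B\<close> for the partial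
  sum \<open>B\<close> of the squares, and hence \<open>B \<le> (norm y * K)\<^sup>2\<close>.
\<close>
lemma summable_adjoint_coeffs:
  fixes e :: "nat \<Rightarrow> 'a::chilbert_space" and T :: "'a \<Rightarrow> 'a"
  assumes T: "bounded_clinear T" and e: "orthonormal_or_zero e"
  shows "summable (\<lambda>n. (cmod (cinner y (T (e n))))\<^sup>2)"
proof -
  have bl: "bounded_linear T" and lin: "\<And>c x. T (c *\<^sub>C x) = c *\<^sub>C T x"
    using T by (auto simp: bounded_clinear_def)
  obtain K where K: "0 < K" "\<And>x. norm (T x) \<le> norm x * K"
    using bounded_linear.pos_bounded[OF bl] by blast
  show ?thesis
  proof (rule summableI_nonneg_bounded)
    fix n
    let ?c = "\<lambda>i. cinner y (T (e i))"
    let ?z = "\<Sum>i<n. ?c i *\<^sub>C e i"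
    let ?B = "\<Sum>i<n. (cmod (?c i))\<^sup>2"
    have B0: "0 \<le> ?B" by (simp add: sum_nonneg)
    have "cinner y (T ?z) = of_real ?B"
      by (simp add: linear_sum[OF bounded_linear.linear[OF bl]] lin cinner_sum_right
          cinner_scaleC_right mult_cnj_cmod mult.commute)
    then have "?B = cmod (cinner y (T ?z))"
      using B0 by (simp only: norm_of_real abs_of_nonneg)
    also have "\<dots> \<le> norm y * norm (T ?z)"
      by (rule cinner_Cauchy_Schwarz)
    also have "\<dots> \<le> norm y * (norm ?z * K)"
      by (intro mult_left_mono K) simp
    finally have "?B\<^sup>2 \<le> (norm y * (norm ?z * K))\<^sup>2"
      using B0 by (intro power_mono)
    also have "\<dots> = (norm y * K)\<^sup>2 * (norm ?z)\<^sup>2"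
      by (simp add: power_mult_distrib)
    also have "\<dots> \<le> (norm y * K)\<^sup>2 * ?B"
      by (intro mult_left_mono norm_orthonormal_sum_le e) auto
    finally have "?B * ?B \<le> (norm y * K)\<^sup>2 * ?B"
      by (simp only: power2_eq_square)
    then show "?B \<le> (norm y * K)\<^sup>2"
      using B0 by (cases "?B = 0") (auto simp: mult_le_cancel_right)
  qed simp
qed

lemma cinner_cadjoint:
  fixes e :: "nat \<Rightarrow> 'a::chilbert_space" and T :: "'a \<Rightarrow> 'a"
  assumes T: "bounded_clinear T" and e: "orthonormal_or_zero e" "total_sequence e"
  shows "cinner (T x) y = cinner x (cadjoint T y)"
proof -
  have bl: "bounded_linear T" and lin: "\<And>c x. T (c *\<^sub>C x) = c *\<^sub>C T x"
    using T by (auto simp: bounded_clinear_def)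
  define S where "S y = (\<Sum>n. cinner y (T (e n)) *\<^sub>C e n)" for y :: 'a
  have "cinner (T x) y = cinner x (S y)" for x y
  proof -
    \<comment> \<open>Both sides are sums of the series with terms
      \<open>cinner x (e n) * cinner (T (e n)) y\<close>: expand \<open>x\<close> on the left and \<open>S y\<close> on the right.\<close>
    have "(\<lambda>n. T (cinner x (e n) *\<^sub>C e n)) sums T x"
      by (rule bounded_linear.sums[OF bl Fourier_series_sums[OF e]])
    then have "(\<lambda>n. cinner (T (cinner x (e n) *\<^sub>C e n)) y) sums cinner (T x) y"
      by (rule bounded_linear.sums[OF bounded_linear_cinner_left])
    then have l: "(\<lambda>n. cinner x (e n) * cinner (T (e n)) y) sums cinner (T x) y"
      by (simp add: lin cinner_scaleC_left)
    have "(\<lambda>n. cinner y (T (e n)) *\<^sub>C e n) sums S y"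
      unfolding S_def by (intro summable_sums summable_orthonormal summable_adjoint_coeffs e T)
    then have "(\<lambda>n. cinner x (cinner y (T (e n)) *\<^sub>C e n)) sums cinner x (S y)"
      by (rule bounded_linear.sums[OF bounded_linear_cinner_right])
    then have "(\<lambda>n. cinner x (e n) * cinner (T (e n)) y) sums cinner x (S y)"
      by (simp add: cinner_scaleC_right cinner_commute[symmetric] mult.commute)
    with l show ?thesis by (rule sums_unique2)
  qed
  then have "\<exists>S. \<forall>x y. cinner (T x) y = cinner x (S y)" by blast
  then show ?thesis
    unfolding cadjoint_def by (rule someI2_ex) blast
qed

text \<open>
  The adjoint identity is a hypothesis because \<open>cadjoint\<close> is obtained by choice, and so satisfies
  it only once some adjoint is known to exist.
\<close>
lemma hyponormal_iff_norm_le: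
  fixes T :: "'a::chilbert_space \<Rightarrow> 'a"
  assumes adj: "\<And>x y. cinner (T x) y = cinner x (cadjoint T y)"
  shows "hyponormal T \<longleftrightarrow> (\<forall>x. norm (cadjoint T x) \<le> norm (T x))"
proof -
  have "cinner (cadjoint T (T x) - T (cadjoint T x)) x
      = of_real ((norm (T x))\<^sup>2 - (norm (cadjoint T x))\<^sup>2)" for x
  proof -
    have "cinner (cadjoint T (T x)) x = cinner (T x) (T x)"
      by (metis adj cinner_commute)
    then show ?thesis
      by (simp add: cinner_diff_left adj cinner_self)
  qed
  then show ?thesis
    unfolding hyponormal_def positive_operator_def
    by (simp only: nonneg_Reals_of_real_iff diff_ge_0_iff_ge abs_le_square_iff[symmetric]
        abs_norm_cancel)
qed


section \<open>Gram-Schmidt orthonormalization\<close>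

text \<open>A vector dependent on its predecessors is sent to \<open>0\<close>, since \<open>inverse 0 = 0\<close>.\<close>
fun gram_schmidt :: "(nat \<Rightarrow> 'a::complex_inner) \<Rightarrow> nat \<Rightarrow> 'a" where
  "gram_schmidt v n = sgn (v n - (\<Sum>i<n. cinner (v n) (gram_schmidt v i) *\<^sub>C gram_schmidt v i))"

declare gram_schmidt.simps [simp del]

lemma gram_schmidt_norm: "gram_schmidt v n = 0 \<or> norm (gram_schmidt v n) = 1"
  by (subst (1 2) gram_schmidt.simps) (simp add: norm_sgn sgn_zero_iff)

lemma norm_scaleR_sgn: "norm x *\<^sub>R sgn x = (x::'a::real_normed_vector)"
  by (cases "x = 0") (simp_all add: sgn_div_norm)

lemma gram_schmidt_decomposition:
  "\<exists>r. v n = r *\<^sub>R gram_schmidt v n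
     + (\<Sum>i<n. cinner (v n) (gram_schmidt v i) *\<^sub>C gram_schmidt v i)"
proof -
  let ?w = "v n - (\<Sum>i<n. cinner (v n) (gram_schmidt v i) *\<^sub>C gram_schmidt v i)"
  have "gram_schmidt v n = sgn ?w"
    by (rule gram_schmidt.simps)
  then have "norm ?w *\<^sub>R gram_schmidt v n = ?w"
    by (simp add: norm_scaleR_sgn)
  then show ?thesis
    by (intro exI[of _ "norm ?w"]) simp
qed

lemma gram_schmidt_orthogonal_less: "j < n \<Longrightarrow> cinner (gram_schmidt v n) (gram_schmidt v j) = 0"
proof (induction n arbitrary: j rule: less_induct)
  case (less n)
  let ?g = "gram_schmidt v"
  have "cinner (?g i) (?g j) = 0" if "i < n" "i \<noteq> j" for i
    using less.IH[of i j] less.IH[of j i] that less.prems cinner_eq_zero_commute[of "?g i" "?g j"]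
    by (cases i j rule: linorder_cases) auto
  then have "(\<Sum>i<n. cinner (v n) (?g i) * cinner (?g i) (?g j))
      = (\<Sum>i<n. if i = j then cinner (v n) (?g j) * cinner (?g j) (?g j) else 0)"
    by (intro sum.cong) auto
  also have "\<dots> = cinner (v n) (?g j) * cinner (?g j) (?g j)"
    using less.prems by simp
  also have "\<dots> = cinner (v n) (?g j)"
    using gram_schmidt_norm[of v j] by (auto simp: cinner_self)
  finally show ?case
    by (subst gram_schmidt.simps)
      (simp add: sgn_div_norm cinner_scaleR_left cinner_diff_left cinner_sum_left cinner_scaleC_left)
qed

lemma gram_schmidt_orthonormal: "orthonormal_or_zero (gram_schmidt v)"
  unfolding orthonormal_or_zero_def
proof (intro conjI allI impI gram_schmidt_norm)
  fix i j :: nat assume "i \<noteq> j"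
  then show "cinner (gram_schmidt v i) (gram_schmidt v j) = 0"
    using gram_schmidt_orthogonal_less[of i j v] gram_schmidt_orthogonal_less[of j i v]
      cinner_eq_zero_commute[of "gram_schmidt v i" "gram_schmidt v j"]
    by (cases i j rule: linorder_cases) auto
qed

text \<open>
  Each \<open>v n\<close> lies in the span of the first \<open>n + 1\<close> orthonormalized vectors, so anything
  orthogonal to all of these is orthogonal to the original sequence.
\<close>
lemma gram_schmidt_total:
  assumes "total_sequence v"
  shows "total_sequence (gram_schmidt v)"
  unfolding total_sequence_def
proof (intro allI impI)
  fix x assume x: "\<forall>n. cinner x (gram_schmidt v n) = 0"
  have "cinner x (v n) = 0" for n
  proof -
    obtain r where "v n = r *\<^sub>R gram_schmidt v n
        + (\<Sum>i<n. cinner (v n) (gram_schmidt v i) *\<^sub>C gram_schmidt v i)"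
      using gram_schmidt_decomposition by blast
    then show ?thesis
      using x by (metis (no_types, lifting) add_0 cinner_add_right cinner_scaleC_right
          cinner_scaleR_right cinner_sum_right mult_zero_right sum.neutral)
  qed
  then show "x = 0"
    using assms unfolding total_sequence_def by blast
qed


section \<open>A total sequence in \<open>L\<^sup>2(\<real>)\<close>\<close>

lemma borel_eq_atMost_rat: "(borel :: real measure) = sigma UNIV (range (\<lambda>q::rat. {..of_rat q}))"
proof (rule borel_eq_sigmaI1[OF borel_eq_atMost])
  fix X :: "real set" assume "X \<in> range atMost"
  then obtain a where a: "X = {..a}" by blast
  have "X = (\<Inter>q\<in>{q::rat. a < of_rat q}. {..of_rat q :: real})"
  proof (intro set_eqI iffI)
    fix x assume x: "x \<in> (\<Inter>q\<in>{q::rat. a < of_rat q}. {..of_rat q :: real})"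
    show "x \<in> X"
    proof (rule ccontr)
      assume "x \<notin> X"
      then obtain q :: rat where "a < of_rat q" "of_rat q < x"
        using of_rat_dense[of a x] by (auto simp: a)
      with x show False by force
    qed
  qed (auto simp: a)
  also have "\<dots> \<in> sets (sigma UNIV (range (\<lambda>q::rat. {..of_rat q :: real})))"
    using of_rat_dense[of a "a + 1"] by (intro sets.countable_INT') auto
  finally show "X \<in> sets (sigma UNIV (range (\<lambda>q::rat. {..of_rat q})))" .
qed auto

text \<open>
  The sets over which \<open>g\<close> integrates to zero form a Dynkin system, and the rational half-lines
  generate the Borel sets and are closed under intersection.
\<close>
lemma AE_zero_if_integral_atMost_rat_zero:
  fixes g :: "real \<Rightarrow> complex"
  assumes g: "integrable lborel g"
    and zero: "(LINT x|lborel. g x) = 0"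
    and atMost: "\<And>q::rat. (LINT x:{..of_rat q}|lborel. g x) = 0"
  shows "AE x in lborel. g x = 0"
proof (rule sigma_finite_measure.density_zero[OF lborel.sigma_finite_measure_axioms g])
  fix A :: "real set" assume "A \<in> sets lborel"
  then have A: "A \<in> sigma_sets UNIV (range (\<lambda>q::rat. {..of_rat q}))"
    by (simp add: borel_eq_atMost_rat)
  have stable: "Int_stable (range (\<lambda>q::rat. {..of_rat q :: real}))"
  proof (rule Int_stableI)
    fix A B assume "A \<in> range (\<lambda>q::rat. {..of_rat q :: real})" "B \<in> range (\<lambda>q::rat. {..of_rat q :: real})"
    then obtain p q :: rat where "A = {..of_rat p}" "B = {..of_rat q}" by auto
    then have "A \<inter> B = {..of_rat (min p q)}" by (auto simp: min_def of_rat_less_eq)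
    then show "A \<inter> B \<in> range (\<lambda>q::rat. {..of_rat q :: real})" by blast
  qed
  have "range (\<lambda>q::rat. {..of_rat q :: real}) \<subseteq> Pow UNIV" by simp
  from stable this A show "(LINT x:A|lborel. g x) = 0"
  proof (induction rule: sigma_sets_induct_disjoint)
    case (basic A)
    then show ?case using atMost by auto
  next
    case empty
    show ?case by (simp add: set_lebesgue_integral_def)
  next
    case (compl A)
    then have A: "A \<in> sets lborel"
      by (simp add: borel_eq_atMost_rat)
    have "(LINT x:A \<union> (UNIV - A)|lborel. g x) = (LINT x:A|lborel. g x) + (LINT x:UNIV - A|lborel. g x)"
      using A g by (intro set_integral_Un) (auto simp: set_integrable_def intro!: integrable_mult_indicator)
    moreover have "A \<union> (UNIV - A) = UNIV" by auto
    ultimately show ?case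
      using compl zero by (simp add: set_lebesgue_integral_def)
  next
    case (union A)
    then have A: "A i \<in> sets lborel" for i
      by (auto simp: borel_eq_atMost_rat)
    have "(LINT x:(\<Union>i. A i)|lborel. g x) = (\<Sum>i. LINT x:A i|lborel. g x)"
    proof (rule lebesgue_integral_countable_add)
      show "set_integrable lborel (\<Union>i. A i) g"
        unfolding set_integrable_def using A g by (intro integrable_mult_indicator) auto
    qed (use A union in \<open>auto simp: disjoint_family_on_def\<close>)
    then show ?case using union by simp
  qed
qed

lemma square_integrable_indicator_Ioc:
  "square_integrable (\<lambda>x::real. of_real (indicator {a<..b} x))"
proof -
  have "(\<lambda>x. (cmod (of_real (indicator {a<..b} x)))\<^sup>2) = (indicator {a<..b} :: real \<Rightarrow> real)"
    by (auto simp: indicator_def)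
  then show ?thesis
    by (cases "a \<le> b") (auto simp: square_integrable_def)
qed

lemma cinner_abs_L2:
  assumes "square_integrable f" "square_integrable g"
  shows "cinner (abs_L2 f) (abs_L2 g) = (LINT x|lborel. f x * cnj (g x))"
  using assms by (intro cinner_L2.abs_eq) (simp_all add: L2_rel_def)

lemma abs_L2_eq_zero:
  assumes "square_integrable f" "AE x in lborel. f x = 0"
  shows "abs_L2 f = 0"
  using assms Quotient_rel[OF Quotient_L2, of f "\<lambda>x. 0"]
  by (simp add: zero_L2_def L2_rel_def square_integrable_zero)

definition rat_interval_L2 :: "nat \<Rightarrow> L2" where
  "rat_interval_L2 k = (case from_nat k :: rat \<times> rat of (p, q) \<Rightarrow>
     abs_L2 (\<lambda>x. of_real (indicator {of_rat p<..of_rat q} x)))"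

text \<open>
  On each window \<open>{-m<..m}\<close> a square-integrable function is integrable, and its integral over a
  rational half-line cut to the window is an inner product with a rational interval.
\<close>
lemma rat_interval_L2_total: "total_sequence rat_interval_L2"
  unfolding total_sequence_def
proof (intro allI impI)
  fix y :: L2 assume y: "\<forall>n. cinner y (rat_interval_L2 n) = 0"
  obtain f where f: "square_integrable f" "y = abs_L2 f" by (rule L2_obtain)
  let ?I = "\<lambda>p q x. complex_of_real (indicator {of_rat p<..of_rat q :: real} x)"
  have zero: "(LINT x|lborel. f x * ?I p q x) = 0" for p q :: rat
  proof -
    have "cinner y (abs_L2 (?I p q)) = 0"
      using y[rule_format, of "to_nat (p, q)"] by (simp add: rat_interval_L2_def)
    then show ?thesis
      by (simp add: f(2) cinner_abs_L2[OF f(1) square_integrable_indicator_Ioc])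
  qed
  have window: "AE x in lborel. f x * ?I (- of_nat m) (of_nat m) x = 0" for m
  proof (rule AE_zero_if_integral_atMost_rat_zero)
    show "integrable lborel (\<lambda>x. f x * ?I (- of_nat m) (of_nat m) x)"
      using integrable_mult_cnj[OF f(1) square_integrable_indicator_Ioc] by simp
    show "(LINT x|lborel. f x * ?I (- of_nat m) (of_nat m) x) = 0"
      by (rule zero)
    fix q :: rat
    have le: "of_nat m \<le> q \<longleftrightarrow> real m \<le> of_rat q"
      using of_rat_less_eq[of "of_nat m" q, where 'a = real] by simp
    have "(LINT x:{..of_rat q}|lborel. f x * ?I (- of_nat m) (of_nat m) x)
        = (LINT x|lborel. f x * ?I (- of_nat m) (min (of_nat m) q) x)"
      unfolding set_lebesgue_integral_def
      by (intro Bochner_Integration.integral_cong)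
        (auto simp: indicator_def min_def le split: if_splits)
    then show "(LINT x:{..of_rat q}|lborel. f x * ?I (- of_nat m) (of_nat m) x) = 0"
      by (simp only: zero)
  qed
  have "AE x in lborel. \<forall>m. f x * ?I (- of_nat m) (of_nat m) x = 0"
    unfolding AE_all_countable using window by blast
  then have "AE x in lborel. f x = 0"
  proof eventually_elim
    case (elim x)
    obtain m :: nat where "\<bar>x\<bar> < of_nat m"
      using reals_Archimedean2 by blast
    then have "x \<in> {of_rat (- of_nat m)<..of_rat (of_nat m)}"
      by (auto simp: of_rat_minus)
    with elim[rule_format, of m] show ?case by simp
  qed
  then show "y = 0"
    using f abs_L2_eq_zero by simp
qed

lemma L2_orthonormal_total:
  obtains e :: "nat \<Rightarrow> L2" where "orthonormal_or_zero e" "total_sequence e"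
  using gram_schmidt_orthonormal gram_schmidt_total[OF rat_interval_L2_total] by blast


section \<open>Hyponormality and tight frames\<close>

theorem theorem3p9:
  fixes \<Theta> :: "L2 \<Rightarrow> L2"
  assumes "bounded_clinear \<Theta>" and "\<Theta> \<noteq> id"
  shows "hyponormal \<Theta> \<longleftrightarrow> (\<exists>f :: nat \<Rightarrow> L2. theta_tight_frame \<Theta> 1 f)"
proof -
  obtain e :: "nat \<Rightarrow> L2" where e: "orthonormal_or_zero e" "total_sequence e"
    by (rule L2_orthonormal_total)
  note adj = cinner_cadjoint[OF assms(1) e]
  note hypo = hyponormal_iff_norm_le[OF adj]
  show ?thesis
  proof
    assume "hyponormal \<Theta>"
    then have le: "norm (cadjoint \<Theta> x) \<le> norm (\<Theta> x)" for x
      by (simp add: hypo)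
    have "cinner x (\<Theta> (e n)) = cinner (cadjoint \<Theta> x) (e n)" for x n
      by (metis adj cinner_commute)
    then have "(\<lambda>n. (cmod (cinner x (\<Theta> (e n))))\<^sup>2) sums (norm (cadjoint \<Theta> x))\<^sup>2" for x
      using Parseval_sums[OF e, of "cadjoint \<Theta> x"] by simp
    then have "theta_tight_frame \<Theta> 1 (\<lambda>n. \<Theta> (e n))"
      using le assms(2)
      by (auto simp: theta_tight_frame_def theta_frame_def sums_iff intro!: power_mono)
    then show "\<exists>f :: nat \<Rightarrow> L2. theta_tight_frame \<Theta> 1 f" by blast
  next
    assume "\<exists>f :: nat \<Rightarrow> L2. theta_tight_frame \<Theta> 1 f"
    then obtain f :: "nat \<Rightarrow> L2" where f: "theta_frame \<Theta> 1 1 f"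
      unfolding theta_tight_frame_def by blast
    have "(norm (cadjoint \<Theta> x))\<^sup>2 \<le> (norm (\<Theta> x))\<^sup>2" for x
    proof -
      have "(norm (cadjoint \<Theta> x))\<^sup>2 \<le> (\<Sum>n. (cmod (cinner x (f n)))\<^sup>2)"
        using f by (simp add: theta_frame_def)
      also have "\<dots> \<le> (norm (\<Theta> x))\<^sup>2"
        using f by (simp add: theta_frame_def)
      finally show ?thesis .
    qed
    then have "norm (cadjoint \<Theta> x) \<le> norm (\<Theta> x)" for x
      by (rule power2_le_imp_le) simp
    then show "hyponormal \<Theta>"
      by (simp add: hypo)
  qed
qed

end
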